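(* Let $n\ge2$, let $\phi$ be a real number with $|\phi|<1$, $\phi\neq0$, and let $\gamma>0$. Put $b=\phi/|\phi|$, $c=(1+\gamma+\phi^2)/|\phi|$ and $d=(1+\gamma)/|\phi|$. Let $Q$ be the real symmetric $n\times n$ tridiagonal matrix with $Q_{11}=Q_{nn}=d$, $Q_{ii}=c$ for $2\le i\le n-1$, $Q_{i,i+1}=Q_{i+1,i}=-b$ for $1\le i\le n-1$, and all other entries $0$. Let $s_i$ denote the sum of the $i$th row of $Q^{-1}$. Then for every $i=1,\dots,n$: if $0<\phi<1$, $$\frac{1}{d-\phi}<s_i<\frac{1}{c-2};$$ and if $-1<\phi<0$, $$\frac{2}{c+2}-\frac{1}{d+\phi}<s_i<\frac{1}{d+\phi}.$$
   Context: With these parameters $c>2$, $d>1$, and $Q$ is invertible. *)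

theory Defs
  imports
    Complex_Main
    "Jordan_Normal_Form.Matrix"
    "Jordan_Normal_Form.Gauss_Jordan_Elimination"
    "Jordan_Normal_Form.Determinant"
begin

text \<open>Rows and columns are numbered from \<open>0\<close>, so the corner entries sit at \<open>0\<close> and \<open>n - 1\<close>.\<close>

definition tridiag_mat :: "nat \<Rightarrow> real \<Rightarrow> real \<Rightarrow> real \<Rightarrow> real mat" where
  "tridiag_mat n b c d = mat n n (\<lambda>(i, j).
     if i = j then (if i = 0 \<or> i = n - 1 then d else c)
     else if j = Suc i \<or> i = Suc j then - b
     else 0)"

definition row_sum :: "real mat \<Rightarrow> nat \<Rightarrow> real" where
  "row_sum A i = (\<Sum>j<dim_col A. A $$ (i, j))"

text \<open>
  The function \<open>mat_inverse\<close> is option-valued. The remaining facts show that \<open>tridiag_mat n b c d\<close>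
  is invertible for the parameters of interest, so that \<open>the (mat_inverse (tridiag_mat n b c d))\<close>
  is its two-sided inverse and not an unspecified value.
\<close>

lemma params_bounds:
  fixes \<phi> \<gamma> :: real
  assumes "\<bar>\<phi>\<bar> < 1" "\<phi> \<noteq> 0" "\<gamma> > 0"
  shows "\<bar>\<phi> / \<bar>\<phi>\<bar>\<bar> = 1" "(1 + \<gamma> + \<phi>\<^sup>2) / \<bar>\<phi>\<bar> > 2" "(1 + \<gamma>) / \<bar>\<phi>\<bar> > 1"
proof -
  show "\<bar>\<phi> / \<bar>\<phi>\<bar>\<bar> = 1" using assms by simp
  have "0 \<le> (1 - \<bar>\<phi>\<bar>)\<^sup>2" by simp
  then have "2 * \<bar>\<phi>\<bar> \<le> 1 + \<phi>\<^sup>2" by (simp add: power2_diff)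
  then show "(1 + \<gamma> + \<phi>\<^sup>2) / \<bar>\<phi>\<bar> > 2" using assms by (simp add: less_divide_eq)
  show "(1 + \<gamma>) / \<bar>\<phi>\<bar> > 1" using assms by (simp add: less_divide_eq)
qed

lemma diag_dominant_det_nonzero:
  fixes A :: "real mat"
  assumes A: "A \<in> carrier_mat n n"
    and dom: "\<And>i. i < n \<Longrightarrow> (\<Sum>j\<in>{..<n} - {i}. \<bar>A $$ (i, j)\<bar>) < \<bar>A $$ (i, i)\<bar>"
  shows "det A \<noteq> 0"
proof
  assume "det A = 0"
  then obtain v where v: "v \<in> carrier_vec n" "v \<noteq> 0\<^sub>v n" "A *\<^sub>v v = 0\<^sub>v n"
    using det_0_iff_vec_prod_zero[OF A] by blast
  have "\<exists>k<n. v $ k \<noteq> 0"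
  proof (rule ccontr)
    assume "\<not> ?thesis"
    then have "v = 0\<^sub>v n" using v(1) by (intro eq_vecI) auto
    with v(2) show False by simp
  qed
  then obtain k where k: "k < n" "v $ k \<noteq> 0" by blast
  define M where "M = Max ((\<lambda>i. \<bar>v $ i\<bar>) ` {..<n})"
  have "M \<in> (\<lambda>i. \<bar>v $ i\<bar>) ` {..<n}" unfolding M_def using k by (intro Max_in) auto
  then obtain i where i: "i < n" "M = \<bar>v $ i\<bar>" by auto
  have le: "\<bar>v $ j\<bar> \<le> \<bar>v $ i\<bar>" if "j < n" for j
    unfolding i(2)[symmetric] M_def using that by (intro Max_ge) auto
  have pos: "\<bar>v $ i\<bar> > 0" using le[OF k(1)] k(2) by simp
  have "0 = (A *\<^sub>v v) $ i" using v(3) i by simp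
  also have "\<dots> = (\<Sum>j<n. A $$ (i, j) * v $ j)"
    using A v(1) i by (auto simp: scalar_prod_def lessThan_atLeast0 intro!: sum.cong)
  also have "\<dots> = A $$ (i, i) * v $ i + (\<Sum>j\<in>{..<n} - {i}. A $$ (i, j) * v $ j)"
    using i by (subst sum.remove[of _ i]) auto
  finally have "\<bar>A $$ (i, i) * v $ i\<bar> = \<bar>\<Sum>j\<in>{..<n} - {i}. A $$ (i, j) * v $ j\<bar>" by linarith
  also have "\<dots> \<le> (\<Sum>j\<in>{..<n} - {i}. \<bar>A $$ (i, j)\<bar> * \<bar>v $ j\<bar>)"
    by (rule order_trans[OF sum_abs]) (simp add: abs_mult)
  also have "\<dots> \<le> (\<Sum>j\<in>{..<n} - {i}. \<bar>A $$ (i, j)\<bar> * \<bar>v $ i\<bar>)"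
    by (intro sum_mono mult_left_mono le) auto
  also have "\<dots> = (\<Sum>j\<in>{..<n} - {i}. \<bar>A $$ (i, j)\<bar>) * \<bar>v $ i\<bar>" by (simp add: sum_distrib_right)
  also have "\<dots> < \<bar>A $$ (i, i)\<bar> * \<bar>v $ i\<bar>" using dom[OF i(1)] pos by simp
  finally show False by (simp add: abs_mult)
qed

lemma tridiag_mat_det_nonzero:
  assumes "\<bar>b\<bar> = 1" "c > 2" "d > 1"
  shows "det (tridiag_mat n b c d) \<noteq> 0"
proof (rule diag_dominant_det_nonzero)
  show "tridiag_mat n b c d \<in> carrier_mat n n" by (simp add: tridiag_mat_def)
  fix i assume i: "i < n"
  let ?N = "{j. j < n \<and> (j = Suc i \<or> i = Suc j)}"
  have "(\<Sum>j\<in>{..<n} - {i}. \<bar>tridiag_mat n b c d $$ (i, j)\<bar>)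
      = (\<Sum>j\<in>{..<n} - {i}. if j \<in> ?N then 1 else 0)"
    using i assms by (intro sum.cong) (auto simp: tridiag_mat_def)
  also have "\<dots> = real (card (({..<n} - {i}) \<inter> ?N))"
    by (auto simp: sum.If_cases intro!: arg_cong[where f = card])
  also have "({..<n} - {i}) \<inter> ?N = ?N" by auto
  finally have sum: "(\<Sum>j\<in>{..<n} - {i}. \<bar>tridiag_mat n b c d $$ (i, j)\<bar>) = real (card ?N)" .
  show "(\<Sum>j\<in>{..<n} - {i}. \<bar>tridiag_mat n b c d $$ (i, j)\<bar>) < \<bar>tridiag_mat n b c d $$ (i, i)\<bar>"
  proof (cases "i = 0 \<or> i = n - 1")
    case True
    then have "?N \<subseteq> {if i = 0 then 1 else i - 1}" using i by auto
    then have "card ?N \<le> 1" using card_mono[of "{if i = 0 then 1 else i - 1}" ?N] by simp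
    then show ?thesis unfolding sum using True i assms by (simp add: tridiag_mat_def)
  next
    case False
    have "?N \<subseteq> {i - 1, Suc i}" by auto
    then have "card ?N \<le> card {i - 1, Suc i}" by (intro card_mono) auto
    also have "\<dots> \<le> 2" by (simp add: card_insert_if)
    finally show ?thesis unfolding sum using False i assms by (simp add: tridiag_mat_def)
  qed
qed

lemma tridiag_mat_inverse:
  fixes n :: nat and b c d :: real
  assumes "\<bar>b\<bar> = 1" "c > 2" "d > 1"
  defines "Q \<equiv> tridiag_mat n b c d"
  shows "the (mat_inverse Q) \<in> carrier_mat n n"
    and "Q * the (mat_inverse Q) = 1\<^sub>m n"
    and "the (mat_inverse Q) * Q = 1\<^sub>m n"
proof -
  have Q: "Q \<in> carrier_mat n n" by (simp add: Q_def tridiag_mat_def)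
  have "Q \<in> Units (ring_mat TYPE(real) n ())"
    using det_non_zero_imp_unit[OF Q] tridiag_mat_det_nonzero[OF assms(1-3)] by (simp add: Q_def)
  then obtain B where B: "mat_inverse Q = Some B"
    using mat_inverse(1)[OF Q, of "()"] by (cases "mat_inverse Q") blast+
  show "the (mat_inverse Q) \<in> carrier_mat n n" "Q * the (mat_inverse Q) = 1\<^sub>m n"
    "the (mat_inverse Q) * Q = 1\<^sub>m n"
    using mat_inverse(2)[OF Q B] B by auto
qed

end

theory Submission
  imports Defs
begin

text \<open>
  The vector \<open>s\<close> of row sums solves \<open>Q s = (1, \<dots>, 1)\<close>. Since \<open>c - 2b\<close> is the sum of each interior row
  of \<open>Q\<close>, the deviation \<open>w = s - 1 / (c - 2b)\<close> satisfies the homogeneous equation in the interior and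
  \<open>(Q w)\<^sub>1 = (Q w)\<^sub>n = r\<close> with \<open>r = (\<bar>\<phi>\<bar> - b) / (c - 2b)\<close>. By the maximum principle
  \<open>\<bar>w\<bar> \<le> \<bar>r\<bar> / (d - 1)\<close>, and \<open>c = d + \<bar>\<phi>\<bar> > 2\<close> makes this strictly smaller than
  \<open>2 \<bar>r\<bar> / (d - \<bar>\<phi>\<bar>)\<close>, which is the distance from \<open>1 / (c - 2b)\<close> to the bounds involving \<open>d\<close>.
  For \<open>\<phi> > 0\<close> the upper bound \<open>1 / (c - 2)\<close> says that \<open>w\<close> is negative, which is the strong
  maximum principle, as then \<open>r < 0\<close>.
\<close>

lemma tridiag_mat_row_sum_mult:
  fixes x :: "nat \<Rightarrow> real"
  assumes "n \<ge> 2"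
  shows "(\<Sum>j<n. tridiag_mat n b c d $$ (0, j) * x j) = d * x 0 - b * x 1"
    and "(\<Sum>j<n. tridiag_mat n b c d $$ (n - 1, j) * x j) = d * x (n - 1) - b * x (n - 2)"
    and "Suc (Suc i) < n \<Longrightarrow>
      (\<Sum>j<n. tridiag_mat n b c d $$ (Suc i, j) * x j) = c * x (Suc i) - b * (x i + x (Suc (Suc i)))"
proof -
  have "(\<Sum>j<n. tridiag_mat n b c d $$ (0, j) * x j)
      = (\<Sum>j\<in>{0, 1}. tridiag_mat n b c d $$ (0, j) * x j)"
    using assms by (intro sum.mono_neutral_right) (auto simp: tridiag_mat_def)
  then show "(\<Sum>j<n. tridiag_mat n b c d $$ (0, j) * x j) = d * x 0 - b * x 1"
    using assms by (simp add: tridiag_mat_def)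
  have "(\<Sum>j<n. tridiag_mat n b c d $$ (n - 1, j) * x j)
      = (\<Sum>j\<in>{n - 1, n - 2}. tridiag_mat n b c d $$ (n - 1, j) * x j)"
    using assms by (intro sum.mono_neutral_right) (auto simp: tridiag_mat_def)
  also have "\<dots> = d * x (n - 1) - b * x (n - 2)"
  proof -
    obtain m where "n = Suc (Suc m)" using assms by (metis add_2_eq_Suc le_Suc_ex)
    then show ?thesis by (simp add: tridiag_mat_def)
  qed
  finally show "(\<Sum>j<n. tridiag_mat n b c d $$ (n - 1, j) * x j) = d * x (n - 1) - b * x (n - 2)" .
  assume i: "Suc (Suc i) < n"
  have "(\<Sum>j<n. tridiag_mat n b c d $$ (Suc i, j) * x j)
      = (\<Sum>j\<in>{i, Suc i, Suc (Suc i)}. tridiag_mat n b c d $$ (Suc i, j) * x j)"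
    using i by (intro sum.mono_neutral_right) (auto simp: tridiag_mat_def)
  then show "(\<Sum>j<n. tridiag_mat n b c d $$ (Suc i, j) * x j)
      = c * x (Suc i) - b * (x i + x (Suc (Suc i)))"
    using i by (auto simp: tridiag_mat_def algebra_simps)
qed

text \<open>The row sums of \<open>B\<close> form \<open>B\<close> applied to the all-ones vector,
  and \<open>A * B\<close> fixes that vector.\<close>

lemma mult_row_sum_right_inverse:
  assumes A: "A \<in> carrier_mat n n" and B: "B \<in> carrier_mat n n"
    and AB: "A * B = 1\<^sub>m n" and i: "i < n"
  shows "(\<Sum>j<n. A $$ (i, j) * row_sum B j) = 1"
proof -
  have "(\<Sum>j<n. A $$ (i, j) * row_sum B j) = (\<Sum>j<n. \<Sum>k<n. A $$ (i, j) * B $$ (j, k))"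
    using B by (simp add: row_sum_def sum_distrib_left)
  also have "\<dots> = (\<Sum>k<n. \<Sum>j<n. A $$ (i, j) * B $$ (j, k))" by (rule sum.swap)
  also have "\<dots> = (\<Sum>k<n. (A * B) $$ (i, k))"
    using A B i by (intro sum.cong) (auto simp: scalar_prod_def lessThan_atLeast0 intro!: sum.cong)
  also have "\<dots> = (\<Sum>k<n. if i = k then 1 else 0)"
    unfolding AB using i by (intro sum.cong) auto
  also have "\<dots> = 1" using i by simp
  finally show ?thesis .
qed

text \<open>Separates the corner rows from the interior ones; an interior index appears as
  \<open>Suc j\<close>, so that its neighbours \<open>j\<close> and \<open>Suc (Suc j)\<close> need
  no subtraction.\<close>

lemma index_trichotomy:
  fixes i n :: nat
  assumes "i < n"
  obtains "i = 0" | "i = n - 1" | j where "i = Suc j" "Suc (Suc j) < n"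
proof (cases i)
  case 0
  then show ?thesis by (rule that(1))
next
  case (Suc j)
  show ?thesis
  proof (cases "Suc (Suc j) < n")
    case True
    with Suc show ?thesis by (rule that(3))
  next
    case False
    then show ?thesis using assms Suc by (intro that(2)) linarith
  qed
qed

text \<open>Look at an index \<open>m\<close> where \<open>\<bar>w\<bar>\<close> is largest. A
  corner row gives \<open>d * \<bar>w m\<bar> \<le> \<bar>r\<bar> + \<bar>w m\<bar>\<close>; an
  interior row gives \<open>c * \<bar>w m\<bar> \<le> 2 * \<bar>w m\<bar>\<close>, which forces
  \<open>w m = 0\<close>.\<close>

lemma tridiag_maximum_principle:
  fixes w :: "nat \<Rightarrow> real"
  assumes n: "n \<ge> 2" and b: "\<bar>b\<bar> = 1" and c: "c > 2" and d: "d > 1"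
    and first: "d * w 0 - b * w 1 = r"
    and last: "d * w (n - 1) - b * w (n - 2) = r"
    and inner: "\<And>i. Suc (Suc i) < n \<Longrightarrow> c * w (Suc i) = b * (w i + w (Suc (Suc i)))"
    and i: "i < n"
  shows "\<bar>w i\<bar> \<le> \<bar>r\<bar> / (d - 1)"
proof -
  obtain m where m: "m < n" and max: "\<And>j. j < n \<Longrightarrow> \<bar>w j\<bar> \<le> \<bar>w m\<bar>"
    using ex_is_arg_min_if_finite[of "{..<n}" "\<lambda>j. - \<bar>w j\<bar>"] i
    by (auto simp: is_arg_min_linorder)
  have boundary: "\<bar>w m\<bar> \<le> \<bar>r\<bar> / (d - 1)" if "d * w m - b * w j = r" "j < n" for j
  proof -
    have "d * \<bar>w m\<bar> = \<bar>d * w m\<bar>" using d by (simp add: abs_mult)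
    also have "\<dots> = \<bar>r + b * w j\<bar>" using that(1) by (simp add: algebra_simps)
    also have "\<dots> \<le> \<bar>r\<bar> + \<bar>w j\<bar>"
      using abs_triangle_ineq[of r "b * w j"] b by (simp add: abs_mult)
    also have "\<dots> \<le> \<bar>r\<bar> + \<bar>w m\<bar>" using max[OF that(2)] by simp
    finally show ?thesis using d by (simp add: le_divide_eq algebra_simps)
  qed
  from m have "\<bar>w m\<bar> \<le> \<bar>r\<bar> / (d - 1)"
  proof (cases rule: index_trichotomy)
    case 1
    then show ?thesis using boundary[of 1] first n by simp
  next
    case 2
    then show ?thesis using boundary[of "n - 2"] last n by simp
  next
    case (3 j)
    have "c * \<bar>w m\<bar> = \<bar>c * w m\<bar>" using c by (simp add: abs_mult)
    also have "\<dots> = \<bar>w j + w (Suc (Suc j))\<bar>" using inner[OF 3(2)] 3(1) b by (simp add: abs_mult)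
    also have "\<dots> \<le> 2 * \<bar>w m\<bar>" using max[of j] max[of "Suc (Suc j)"] 3 by linarith
    finally have "(c - 2) * \<bar>w m\<bar> \<le> 0" by (simp add: algebra_simps)
    then have "\<bar>w m\<bar> = 0" using c by (simp add: mult_le_0_iff)
    then show ?thesis using d by simp
  qed
  with max[OF i] show ?thesis by linarith
qed

text \<open>At a minimiser \<open>m\<close> of \<open>u\<close>, a corner row gives
  \<open>(d - 1) * u m > 0\<close> and an interior row \<open>(c - 2) * u m \<ge> 0\<close>, so
  \<open>u\<close> is nonnegative. Strictness then has to be carried along the chain from a
  corner.\<close>

lemma tridiag_strong_minimum_principle:
  fixes u :: "nat \<Rightarrow> real"
  assumes n: "n \<ge> 2" and c: "c > 2" and d: "d > 1"
    and first: "d * u 0 - u 1 > 0"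
    and last: "d * u (n - 1) - u (n - 2) > 0"
    and inner: "\<And>i. Suc (Suc i) < n \<Longrightarrow> c * u (Suc i) = u i + u (Suc (Suc i))"
    and i: "i < n"
  shows "u i > 0"
proof -
  obtain m where m: "m < n" and min: "\<And>j. j < n \<Longrightarrow> u m \<le> u j"
    using ex_is_arg_min_if_finite[of "{..<n}" u] i by (auto simp: is_arg_min_linorder)
  have boundary: "u m \<ge> 0" if "d * u m - u j > 0" "j < n" for j
  proof -
    have "(d - 1) * u m > 0" using that(1) min[OF that(2)] by (simp add: algebra_simps)
    then show ?thesis using d by (simp add: zero_less_mult_iff)
  qed
  from m have "u m \<ge> 0"
  proof (cases rule: index_trichotomy)
    case 1
    then show ?thesis using boundary[of 1] first n by simp
  next
    case 2
    then show ?thesis using boundary[of "n - 2"] last n by simp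
  next
    case (3 j)
    have "(c - 2) * u m \<ge> 0"
      using inner[OF 3(2)] min[of j] min[of "Suc (Suc j)"] 3 by (simp add: algebra_simps)
    then show ?thesis using c by (simp add: zero_le_mult_iff)
  qed
  then have nonneg: "u j \<ge> 0" if "j < n" for j using min[OF that] by linarith
  \<comment> \<open>Positivity starts at index 0 and spreads to the right through
    \<open>c * u (Suc j) \<ge> u j\<close>; the last index has no right neighbour and uses its own
    row.\<close>
  show ?thesis using i
  proof (induction i)
    case 0
    have "d * u 0 > 0" using first nonneg[of 1] n by simp
    then show ?case using d by (simp add: zero_less_mult_iff)
  next
    case (Suc j)
    show ?case
    proof (cases "Suc (Suc j) < n")
      case True
      have "c * u (Suc j) > 0" using inner[OF True] nonneg[OF True] Suc by simp
      then show ?thesis using c by (simp add: zero_less_mult_iff)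
    next
      case False
      then have "Suc j = n - 1" using Suc.prems by simp
      moreover have "d * u (n - 1) > 0" using last nonneg[of "n - 2"] n by simp
      ultimately show ?thesis using d by (simp add: zero_less_mult_iff)
    qed
  qed
qed

theorem theorem5:
  fixes n :: nat and \<phi> \<gamma> b c d :: real and Q :: "real mat" and s :: "nat \<Rightarrow> real"
  assumes "n \<ge> 2"
    and "\<bar>\<phi>\<bar> < 1" and "\<phi> \<noteq> 0" and "\<gamma> > 0"
    and "b = \<phi> / \<bar>\<phi>\<bar>"
    and "c = (1 + \<gamma> + \<phi>\<^sup>2) / \<bar>\<phi>\<bar>"
    and "d = (1 + \<gamma>) / \<bar>\<phi>\<bar>"
    and "Q = tridiag_mat n b c d"
    and "\<And>i. i < n \<Longrightarrow> s i = row_sum (the (mat_inverse Q)) i"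
  shows "\<forall>i<n.
      (0 < \<phi> \<and> \<phi> < 1 \<longrightarrow> 1 / (d - \<phi>) < s i \<and> s i < 1 / (c - 2)) \<and>
      (-1 < \<phi> \<and> \<phi> < 0 \<longrightarrow> 2 / (c + 2) - 1 / (d + \<phi>) < s i \<and> s i < 1 / (d + \<phi>))"
proof -
  define a where "a = \<bar>\<phi>\<bar>"
  have a: "0 < a" "a < 1" using assms by (auto simp: a_def)
  have b: "\<bar>b\<bar> = 1" and c: "c > 2" and d: "d > 1"
    using params_bounds[OF assms(2-4)] assms(5-7) by auto
  have cd: "c = d + a"
    using a unfolding assms(6,7) a_def by (simp add: field_simps power2_eq_square)
  define e where "e = 1 / (c - 2 * b)"
  \<comment> \<open>A corner row of \<open>w\<close> equals \<open>1 - (d - b) * e\<close>;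
    inserting \<open>1 = (c - 2 * b) * e\<close> and \<open>c = d + a\<close> yields this
    value.\<close>
  define r where "r = (a - b) * e"
  define w where "w i = s i - e" for i
  have c2b: "c - 2 * b > 0" using b c by linarith
  then have "(c - 2 * b) * e = 1" by (simp add: e_def)
  then have ce: "c * e - 2 * b * e = 1" by (simp add: algebra_simps)
  have e: "e > 0" using c2b by (simp add: e_def)
  have Qs: "(\<Sum>j<n. Q $$ (i, j) * s j) = 1" if "i < n" for i
  proof -
    have "Q \<in> carrier_mat n n" by (simp add: assms(8) tridiag_mat_def)
    then show ?thesis
      using mult_row_sum_right_inverse[of Q n "the (mat_inverse Q)" i]
        tridiag_mat_inverse[OF b c d, of n] that assms(8,9) by simp
  qed
  note rows = tridiag_mat_row_sum_mult[OF assms(1), where b = b and c = c and d = d and x = s, folded assms(8)]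
  have first: "d * w 0 - b * w 1 = r"
    using Qs[of 0] rows(1) assms(1) ce cd by (simp add: w_def r_def algebra_simps)
  have last: "d * w (n - 1) - b * w (n - 2) = r"
    using Qs[of "n - 1"] rows(2) assms(1) ce cd by (simp add: w_def r_def algebra_simps)
  have inner: "c * w (Suc i) = b * (w i + w (Suc (Suc i)))" if "Suc (Suc i) < n" for i
    using Qs[of "Suc i"] rows(3)[OF that] that ce by (simp add: w_def algebra_simps)
  \<comment> \<open>Nonzero because \<open>a < 1 = \<bar>b\<bar>\<close>; this makes the bound on
    \<open>w\<close> strict.\<close>
  have rpos: "\<bar>r\<bar> > 0" using a b e by (auto simp: r_def)
  have da: "d - a > 0" using a d by linarith
  have "\<bar>r\<bar> / (d - 1) < 2 * \<bar>r\<bar> / (d - a)"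
  proof -
    \<comment> \<open>The inequality \<open>d - a < 2 * (d - 1)\<close> amounts to
      \<open>d + a > 2\<close>, that is, \<open>c > 2\<close>.\<close>
    have "\<bar>r\<bar> * (d - a) < \<bar>r\<bar> * (2 * (d - 1))"
      using rpos c cd by (intro mult_strict_left_mono) auto
    then show ?thesis using da d by (simp add: divide_simps mult_ac)
  qed
  then have bound: "\<bar>w i\<bar> < 2 * \<bar>r\<bar> / (d - a)" if "i < n" for i
    using tridiag_maximum_principle[where w = w, OF assms(1) b c d first last inner that] by linarith
  show ?thesis
  proof (intro allI impI conjI; elim conjE)
    fix i assume i: "i < n" and phi: "0 < \<phi>" "\<phi> < 1"
    have b1: "b = 1" and a1: "a = \<phi>" using phi assms(5) by (auto simp: a_def)
    \<comment> \<open>Here \<open>\<bar>r\<bar> = (1 - a) * e\<close> and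
      \<open>d - a = c - 2 * a\<close>, while the reciprocals of \<open>c - 2\<close> and
      \<open>c - 2 * a\<close> differ by a fraction with numerator
      \<open>2 * (1 - a)\<close>.\<close>
    have "2 * \<bar>r\<bar> / (d - a) = e - 1 / (d - \<phi>)"
      using a e da c cd b1 a1 by (simp add: r_def abs_mult e_def field_simps)
    then show "1 / (d - \<phi>) < s i" using bound[OF i] by (simp add: w_def abs_less_iff)
    \<comment> \<open>The bound on \<open>\<bar>w\<bar>\<close> cannot give \<open>w i < 0\<close>,
      so the sign is found separately: \<open>- w\<close> satisfies the interior equation and has
      corner values \<open>- r\<close>.\<close>
    have "- r > 0" using phi b1 a1 e by (simp add: r_def mult_neg_pos)
    then have "- w i > 0"
      using first last inner b1
      by (intro tridiag_strong_minimum_principle[OF assms(1) c d, where u = "\<lambda>i. - w i"] i) auto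
    then show "s i < 1 / (c - 2)" by (simp add: w_def e_def b1)
  next
    fix i assume i: "i < n" and phi: "-1 < \<phi>" "\<phi> < 0"
    have b1: "b = -1" and a1: "a = - \<phi>" using phi assms(5) by (auto simp: a_def)
    \<comment> \<open>The same computation with \<open>r = (1 + a) * e\<close>,
      \<open>e = 1 / (c + 2)\<close> and \<open>d + \<phi> = c - 2 * a\<close>.\<close>
    have eq: "2 * \<bar>r\<bar> / (d - a) = 1 / (d + \<phi>) - e"
      using a e da c cd b1 a1 by (simp add: r_def abs_mult e_def field_simps)
    then show "s i < 1 / (d + \<phi>)" using bound[OF i] by (simp add: w_def abs_less_iff)
    \<comment> \<open>The two bounds are symmetric about \<open>e\<close>, so the estimate of
      \<open>\<bar>w i\<bar>\<close> serves both.\<close>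
    have "2 / (c + 2) = 2 * e" by (simp add: e_def b1)
    then show "2 / (c + 2) - 1 / (d + \<phi>) < s i"
      using bound[OF i] eq by (simp add: w_def abs_less_iff)
  qed
qed

end
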